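(* In the $N$-player $K$-arm competitive multi-armed bandit game, the Combined Informational and Side-Payment (CISP) mechanism keeps ex-post budget balance for the social planner at any time.
   Context: Game. Players $\mathbb N=\{1,\dots,N\}$ and arms $\mathbb K=\{1,\dots,K\}$ with $K>N$; time $t\in\mathbb T=\{1,2,\dots\}$. Arm $k$ has condition $r_k(t)\in\{0,1\}$, a Bernoulli process in $t$ with unknown mean $\mu_k\in(0,1)$; $|\mu_i-\mu_j|>\eta$ for any two distinct arms $i,j$, where $\eta>0$ is infinitesimal. At each $t$ the players simultaneously choose arms $\pi_n(t)\in\mathbb K$. Let $\mathbb N_k(t)=\{n:\pi_n(t)=k\}$. If $|\mathbb N_k(t)|=1$, the sole player pulls arm $k$ and receives $r_k^n(t)=r_k(t)$. If $|\mathbb N_k(t)|>1$, exactly one player of $\mathbb N_k(t)$, chosen uniformly at random, pulls arm $k$ and receives $r_k^n(t)=r_k(t)$; the others experience a collision, get reward $0$ and do not observe $r_k(t)$. The indicator $\sigma_n(t)=1$ if player $n$ experiences a collision at $t$, else $0$. Learning. $c_k^n(t)$ is the number of times player $n$ has pulled arm $k$ before time $t$ (it increases by one exactly when $\pi_n(t)=k$ and $\sigma_n(t)=0$). Player $n$'s empirical mean reward is $\tilde\mu_k^n(t+1)=\frac{\sum_{\tau=1}^t r_k^n(\tau)\mathbf 1\{\pi_n(\tau)=k\}}{c_k^n(t+1)}$ when $c_k^n(t+1)>0$, and equals an initial private preference $\theta_k^n$ when the count is $0$; $\tilde{\boldsymbol\mu}^n(t)=(\tilde\mu_k^n(t))_k$.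 The expected immediate reward is $\tilde r_k^n(t)=\Pr(\sigma_n(t)=0)\,\tilde\mu_k^n(t)$ with $\Pr(\sigma_n(t)=0)=1/|\mathbb N_k(t)|$. When deciding, player $n$ estimates $|\mathbb N_k(t)|$ by solving the Nash equilibrium in which all players hold its belief $\tilde{\boldsymbol\mu}^n(t)$. Selfish policy. With discount factor $\rho\in(0,1)$, player $n$ chooses (pure strategies) $\pi_n^{(s)}(t)$ attaining $V_n^{(s)}(\tilde{\boldsymbol\mu}^n(t))=\max_{\pi_n^{(s)}(t)\in\mathbb K}\{\tilde r^n_{\pi_n^{(s)}(t)}(t)+\rho\,\mathbb E[V_n^{(s)}(\tilde{\boldsymbol\mu}^n(t+1))\mid r^n_{\pi_n^{(s)}(t)}(t)]\}$. Its exploration threshold $\mathcal T_{j,k}^n(t)$ is the level such that a player $n$ who chose $k$ at $t-1$ switches to $j\ne k$ at $t$ if $\tilde r_j^n(t)>\mathcal T_{j,k}^n(t)$; it lies between $\tilde r_k^n(t)$ and $\tilde r_k^n(t)-\Delta\mu_{j,k}(t)$, where $\Delta\mu_{j,k}(t)=\frac{(c_k^n(t)-c_j^n(t))(1-\tilde r_k^n(t))}{(\mathbb E[|\mathbb N_j(t-1)|\mid\tilde{\boldsymbol\mu}^n(t-1)]+1)(c_k^n(t)c_j^n(t)+c_j^n(t))}$. Socially optimal policy. A planner with access to all observations uses $\tilde\mu_k(t+1)=\frac{\sum_{\tau=1}^t\sum_{n=1}^N\mathbf 1\{\pi_n(\tau)=k\}r_k^n(\tau)}{\sum_{n=1}^N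 c_k^n(t+1)}$, $\tilde{\boldsymbol\mu}(t)=(\tilde\mu_k(t))_k$, and chooses $\boldsymbol\pi^*(t)$ attaining $V^*(\tilde{\boldsymbol\mu}(t))=\max_{\boldsymbol\pi^*(t)}\{\sum_{n}\tilde r^n_{\pi_n^*(t)}(t)+\rho\,\mathbb E[V^*(\tilde{\boldsymbol\mu}(t+1))\mid r^n_{\pi_n^*(t)}(t),\forall n]\}$. Let $\mathbb K^*(t)$ be the set of the $N$ (distinct) arms chosen by this policy at time $t$. CISP mechanism. The social planner observes all players' arm decisions after they pull. A penalty $\Psi\gg1$ is fixed. At each $t\in\mathbb T$: Step 1 (information aggregation): each player $n$ reports $\pi_n^{(s)}(t)$, $\tilde{\boldsymbol\mu}^n(t)$ and $c_k^n(t)$ for all $k$; the planner computes $|\mathbb N_k(t)|$ (the number of players whose selfish decision is $k$, $\mathbb N_k(t)$ denoting the set of these players), the aggregated $\tilde{\boldsymbol\mu}(t)$, and $\mathbb K^*(t)$. Step 2 (informational incentives): to each player $n$ with $\pi_n^{(s)}(t)\notin\mathbb K^*(t)$ it privately recommends an arm $\pi_n^*(t)=k\in\mathbb K^*(t)$ with $|\mathbb N_k(t)|=0$ and $\tilde\mu_k(t)>\mathcal T^n_{k,\pi_n^{(s)}(t)}(t)$, the threshold being evaluated under $\tilde{\boldsymbol\mu}(t)$. Step 3 (side payments): for each $i\in\mathbb K^*(t)$ with $|\mathbb N_i(t)|>1$, it recommends $\pi_n^*(t)=i$ to $n=\arg\max_{h\in\mathbb N_i(t)}\tilde\mu_i^h(t)$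 and charges it $p_i(t)=\frac{|\mathbb N_i(t)|-1}{|\mathbb N_i(t)|}\tilde\mu_i^n(t)$. For each $j\in\mathbb K^*(t)$ with $|\mathbb N_j(t)|=0$, with $\mathbb N^{-n}$ the set of remaining players not yet recommended in Steps 2 or 3, it recommends $\pi_l^*(t)=j$ to $l=\arg\min_{h\in\mathbb N^{-n}}\Big\{\frac{\tilde\mu^h_{\pi_h^{(s)}(t)}(t)}{|\mathbb N_{\pi_h^{(s)}(t)}(t)|}-\tilde\mu_j^h(t)\Big\}$ with $|\mathbb N_{\pi_l^{(s)}(t)}(t)|>1$, gives player $l$, if it follows, the reward $p_j(t)=\frac{\tilde\mu^n_{\pi_l^{(s)}(t)}(t)}{|\mathbb N_{\pi_l^{(s)}(t)}(t)|}-\tilde\mu_j^l(t)$ where $n=\arg\max_{h\in\mathbb N_{\pi_l^{(s)}(t)}(t)}\tilde\mu^h_{\pi_l^{(s)}(t)}(t)$, and announces that $l$ will be charged $p_{\pi_l^{(s)}(t)}(t)$ (defined as $p_i(t)$ above with $i=\pi_l^{(s)}(t)$) if it sticks with $\pi_l^{(s)}(t)$. Step 4 (verification): the planner observes the final decisions $\pi_n^{(\$)}(t)$; every player $n$ with $\pi_n^{(\$)}(t)\ne\pi_n^*(t)$ is charged $\Psi$, which is used to compensate any player $l$ with $\pi_l^*(t)=\pi_n^{(\$)}(t)$. Definition. Ex-post budget balance means that the social planner's budget (charges collected minus rewards paid) is no less than zero at any time in the time horizon.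
   Formalization: The initial private preferences are taken in [0,1], as means of Bernoulli arms (with negative ones the claim fails), and the planner's aggregated mean of an arm nobody has pulled yet, which is 0/0 as written, is an arbitrary value in [0,1]. *)

theory Defs
  imports "HOL-Probability.Probability" "HOL-Library.Extended_Nat"
begin

text \<open>
  Players are the elements of a finite type \<open>'n\<close> and arms those of a finite type \<open>'k\<close>, so
  \<open>N = CARD('n)\<close> and \<open>K = CARD('k)\<close>. Time is \<open>nat\<close>, used from 1 onwards.
\<close>

section \<open>The game\<close>

text \<open>
  \<open>r k t\<close> is the condition of arm \<open>k\<close> at time \<open>t\<close>, and \<open>w k t S\<close> is the player who pulls arm \<open>k\<close> at
  time \<open>t\<close> if \<open>S\<close> is the set of players choosing it. Nothing is assumed about the joint
  distribution across arms or about the dependence between tie-breaks and conditions.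
\<close>

definition bandit_environment ::
  "'w measure \<Rightarrow> ('k::finite \<Rightarrow> real) \<Rightarrow> real \<Rightarrow> ('k \<Rightarrow> nat \<Rightarrow> 'w \<Rightarrow> bool)
     \<Rightarrow> ('k \<Rightarrow> nat \<Rightarrow> 'n::finite set \<Rightarrow> 'w \<Rightarrow> 'n) \<Rightarrow> bool" where
  "bandit_environment M \<mu> \<eta> r w \<longleftrightarrow>
     prob_space M \<and> CARD('n) < CARD('k) \<and>
     (\<forall>k. 0 < \<mu> k \<and> \<mu> k < 1) \<and>
     0 < \<eta> \<and> (\<forall>i j. i \<noteq> j \<longrightarrow> \<eta> < \<bar>\<mu> i - \<mu> j\<bar>) \<and>
     (\<forall>k. prob_space.indep_vars M (\<lambda>_. count_space UNIV) (r k) {1..}) \<and>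
     (\<forall>k. \<forall>t\<ge>1. distr M (count_space UNIV) (r k t) = measure_pmf (bernoulli_pmf (\<mu> k))) \<and>
     (\<forall>k. \<forall>t\<ge>1. \<forall>S. S \<noteq> {} \<longrightarrow>
        w k t S \<in> M \<rightarrow>\<^sub>M count_space UNIV \<and>
        (\<forall>\<omega>\<in>space M. w k t S \<omega> \<in> S) \<and>
        distr M (count_space UNIV) (w k t S) = measure_pmf (pmf_of_set S))"

definition choosers :: "('n \<Rightarrow> 'k) \<Rightarrow> 'k \<Rightarrow> 'n set" where
  "choosers a k = {n. a n = k}"

text \<open>
  From here on everything is defined along one sample path: \<open>x k t\<close> are the arm conditions,
  \<open>v k t S\<close> the tie-breaks and \<open>f t n\<close> the arms finally chosen.
\<close>

definition collides :: "('k \<Rightarrow> nat \<Rightarrow> 'n set \<Rightarrow> 'n) \<Rightarrow> (nat \<Rightarrow> 'n \<Rightarrow> 'k) \<Rightarrow> nat \<Rightarrow> 'n \<Rightarrow> bool" where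
  "collides v f t n \<longleftrightarrow>
     card (choosers (f t) (f t n)) > 1 \<and> v (f t n) t (choosers (f t) (f t n)) \<noteq> n"

definition reward ::
  "('k \<Rightarrow> nat \<Rightarrow> bool) \<Rightarrow> ('k \<Rightarrow> nat \<Rightarrow> 'n set \<Rightarrow> 'n) \<Rightarrow> (nat \<Rightarrow> 'n \<Rightarrow> 'k) \<Rightarrow> 'n \<Rightarrow> 'k \<Rightarrow> nat \<Rightarrow> real" where
  "reward x v f n k t = (if f t n = k \<and> \<not> collides v f t n then of_bool (x k t) else 0)"

section \<open>Learning\<close>

definition pulls ::
  "('k \<Rightarrow> nat \<Rightarrow> 'n set \<Rightarrow> 'n) \<Rightarrow> (nat \<Rightarrow> 'n \<Rightarrow> 'k) \<Rightarrow> 'n \<Rightarrow> nat \<Rightarrow> 'k \<Rightarrow> nat" where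
  "pulls v f n t k = card {\<tau>\<in>{1..<t}. f \<tau> n = k \<and> \<not> collides v f \<tau> n}"

definition emp_mean ::
  "('n \<Rightarrow> 'k \<Rightarrow> real) \<Rightarrow> ('k \<Rightarrow> nat \<Rightarrow> bool) \<Rightarrow> ('k \<Rightarrow> nat \<Rightarrow> 'n set \<Rightarrow> 'n) \<Rightarrow> (nat \<Rightarrow> 'n \<Rightarrow> 'k)
     \<Rightarrow> 'n \<Rightarrow> nat \<Rightarrow> 'k \<Rightarrow> real" where
  "emp_mean \<theta> x v f n t k =
     (if pulls v f n t k = 0 then \<theta> n k
      else (\<Sum>\<tau>\<in>{1..<t}. reward x v f n k \<tau> * of_bool (f \<tau> n = k)) / real (pulls v f n t k))"

definition total_pulls ::
  "('k \<Rightarrow> nat \<Rightarrow> 'n::finite set \<Rightarrow> 'n) \<Rightarrow> (nat \<Rightarrow> 'n \<Rightarrow> 'k) \<Rightarrow> nat \<Rightarrow> 'k \<Rightarrow> nat" where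
  "total_pulls v f t k = (\<Sum>n\<in>UNIV. pulls v f n t k)"

text \<open>\<open>\<theta>a k\<close> is the planner's estimate while nobody has pulled arm \<open>k\<close> (the quotient is then 0/0).\<close>

definition agg_mean ::
  "('k \<Rightarrow> real) \<Rightarrow> ('k \<Rightarrow> nat \<Rightarrow> bool) \<Rightarrow> ('k \<Rightarrow> nat \<Rightarrow> 'n::finite set \<Rightarrow> 'n) \<Rightarrow> (nat \<Rightarrow> 'n \<Rightarrow> 'k)
     \<Rightarrow> nat \<Rightarrow> 'k \<Rightarrow> real" where
  "agg_mean \<theta>a x v f t k =
     (if total_pulls v f t k = 0 then \<theta>a k
      else (\<Sum>\<tau>\<in>{1..<t}. \<Sum>n\<in>UNIV. of_bool (f \<tau> n = k) * reward x v f n k \<tau>)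
             / real (total_pulls v f t k))"

text \<open>
  The empirical means evolve as a Markov chain only together with the pull counts, so value
  functions are taken on pairs (means, counts). \<open>learn b A S\<close> is the state after one pull of every
  arm in \<open>A\<close>, the arms in \<open>S\<close> returning 1 and the others 0; a prior held at count 0 is overwritten.
\<close>

type_synonym 'k belief = "('k \<Rightarrow> real) \<times> ('k \<Rightarrow> nat)"

definition valid_belief :: "'k belief \<Rightarrow> bool" where
  "valid_belief b \<longleftrightarrow> (\<forall>k. 0 \<le> fst b k \<and> fst b k \<le> 1)"

definition learn :: "'k belief \<Rightarrow> 'k set \<Rightarrow> 'k set \<Rightarrow> 'k belief" where
  "learn b A S =
     (\<lambda>k. if k \<in> A then (real (snd b k) * fst b k + of_bool (k \<in> S)) / (real (snd b k) + 1)
          else fst b k,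
      \<lambda>k. if k \<in> A then snd b k + 1 else snd b k)"

section \<open>Selfish policy\<close>

text \<open>Number of players on \<open>k\<close> if player \<open>n\<close> chooses \<open>k\<close> and the others play according to \<open>a\<close>.\<close>

definition load :: "('n \<Rightarrow> 'k) \<Rightarrow> 'n \<Rightarrow> 'k \<Rightarrow> nat" where
  "load a n k = card (insert n (choosers a k))"

definition immediate_reward :: "('k \<Rightarrow> real) \<Rightarrow> ('n \<Rightarrow> 'k) \<Rightarrow> 'n \<Rightarrow> 'k \<Rightarrow> real" where
  "immediate_reward m a n k = 1 / real (load a n k) * m k"

definition nash_equilibrium :: "('k \<Rightarrow> real) \<Rightarrow> ('n \<Rightarrow> 'k) \<Rightarrow> bool" where
  "nash_equilibrium m a \<longleftrightarrow> (\<forall>n k. immediate_reward m a n k \<le> immediate_reward m a n (a n))"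

text \<open>
  \<open>e m\<close> is the equilibrium profile by which a player with belief \<open>m\<close> estimates the others' choices;
  any selection is allowed where the equilibrium is not unique.
\<close>

definition equilibrium_estimate :: "(('k \<Rightarrow> real) \<Rightarrow> 'n \<Rightarrow> 'k) \<Rightarrow> bool" where
  "equilibrium_estimate e \<longleftrightarrow> (\<forall>m. (\<forall>k. 0 \<le> m k \<and> m k \<le> 1) \<longrightarrow> nash_equilibrium m (e m))"

text \<open>
  With probability \<open>1 / load\<close> the player pulls \<open>k\<close> and sees a Bernoulli reward of mean \<open>fst b k\<close>;
  otherwise it collides and learns nothing.
\<close>

definition selfish_payoff ::
  "real \<Rightarrow> 'n \<Rightarrow> (('k \<Rightarrow> real) \<Rightarrow> 'n \<Rightarrow> 'k) \<Rightarrow> ('k belief \<Rightarrow> real) \<Rightarrow> 'k belief \<Rightarrow> 'k \<Rightarrow> real" where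
  "selfish_payoff \<rho> n e V b k =
     (let q = 1 / real (load (e (fst b)) n k) in
        immediate_reward (fst b) (e (fst b)) n k
        + \<rho> * (q * (fst b k * V (learn b {k} {k}) + (1 - fst b k) * V (learn b {k} {}))
               + (1 - q) * V b))"

text \<open>Boundedness singles out the value function among the solutions of the Bellman equation.\<close>

definition selfish_value ::
  "real \<Rightarrow> 'n \<Rightarrow> (('k::finite \<Rightarrow> real) \<Rightarrow> 'n \<Rightarrow> 'k) \<Rightarrow> ('k belief \<Rightarrow> real) \<Rightarrow> bool" where
  "selfish_value \<rho> n e V \<longleftrightarrow>
     (\<exists>B. \<forall>b. valid_belief b \<longrightarrow> \<bar>V b\<bar> \<le> B) \<and>
     (\<forall>b. valid_belief b \<longrightarrow> V b = Max (range (selfish_payoff \<rho> n e V b)))"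

text \<open>
  An \<open>exploration_level\<close> for switching from \<open>k\<close> to \<open>j\<close> is a number such that player \<open>n\<close> prefers \<open>j\<close>
  whenever the expected immediate reward of \<open>j\<close> exceeds it, the rest of the belief being kept. The
  threshold is the least such level; it is extended-real because the levels may be unbounded below.
  A recommendation that clears any particular level, such as one obeying an additional two-sided
  bound, also clears the threshold.
\<close>

definition exploration_level ::
  "real \<Rightarrow> 'n \<Rightarrow> (('k \<Rightarrow> real) \<Rightarrow> 'n \<Rightarrow> 'k) \<Rightarrow> ('k belief \<Rightarrow> real) \<Rightarrow> 'k belief \<Rightarrow> 'k \<Rightarrow> 'k
     \<Rightarrow> real \<Rightarrow> bool" where
  "exploration_level \<rho> n e V b j k z \<longleftrightarrow>
     (\<forall>y\<in>{0..1}. let b' = ((fst b)(j := y), snd b) in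
        z < immediate_reward (fst b') (e (fst b')) n j \<longrightarrow>
        selfish_payoff \<rho> n e V b' k \<le> selfish_payoff \<rho> n e V b' j)"

definition exploration_threshold ::
  "real \<Rightarrow> 'n \<Rightarrow> (('k \<Rightarrow> real) \<Rightarrow> 'n \<Rightarrow> 'k) \<Rightarrow> ('k belief \<Rightarrow> real) \<Rightarrow> 'k belief \<Rightarrow> 'k \<Rightarrow> 'k
     \<Rightarrow> ereal" where
  "exploration_threshold \<rho> n e V b j k = Inf (ereal ` Collect (exploration_level \<rho> n e V b j k))"

section \<open>Socially optimal policy\<close>

text \<open>
  In a joint choice \<open>a\<close> every chosen arm is pulled exactly once; \<open>S\<close> ranges over the possible sets
  of chosen arms that return 1.
\<close>

definition social_payoff ::
  "real \<Rightarrow> ('k belief \<Rightarrow> real) \<Rightarrow> 'k belief \<Rightarrow> ('n::finite \<Rightarrow> 'k) \<Rightarrow> real" where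
  "social_payoff \<rho> V b a =
     (\<Sum>n\<in>UNIV. immediate_reward (fst b) a n (a n))
     + \<rho> * (\<Sum>S\<in>Pow (range a).
              (\<Prod>k\<in>S. fst b k) * (\<Prod>k\<in>range a - S. 1 - fst b k) * V (learn b (range a) S))"

text \<open>The policy \<open>P\<close> attains the maximum over all joint choices and assigns distinct arms.\<close>

definition socially_optimal ::
  "real \<Rightarrow> ('k::finite belief \<Rightarrow> real) \<Rightarrow> ('k belief \<Rightarrow> 'n::finite \<Rightarrow> 'k) \<Rightarrow> bool" where
  "socially_optimal \<rho> V P \<longleftrightarrow>
     (\<exists>B. \<forall>b. valid_belief b \<longrightarrow> \<bar>V b\<bar> \<le> B) \<and>
     (\<forall>b. valid_belief b \<longrightarrow>
        V b = Max (range (social_payoff \<rho> V b :: ('n \<Rightarrow> 'k) \<Rightarrow> real)) \<and>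
        social_payoff \<rho> V b (P b) = V b \<and> inj (P b))"

section \<open>The CISP mechanism\<close>

text \<open>
  One round. \<open>a\<close> is the profile of selfish decisions, \<open>m n k\<close> the reported empirical means, \<open>Ks\<close> the
  socially optimal arms, and \<open>g\<close> the recommended profile (a player whose selfish arm is in \<open>Ks\<close> and
  chosen by nobody else keeps it). \<open>h i\<close> is a player with the best reported mean for \<open>i\<close> among those
  choosing \<open>i\<close>.
\<close>

definition misplaced :: "('n \<Rightarrow> 'k) \<Rightarrow> 'k set \<Rightarrow> 'n set" where
  "misplaced a Ks = {n. a n \<notin> Ks}"

definition congested :: "('n \<Rightarrow> 'k) \<Rightarrow> 'k set \<Rightarrow> 'k set" where
  "congested a Ks = {i\<in>Ks. card (choosers a i) > 1}"

text \<open>The unchosen optimal arms that Step 2 has left for Step 3.\<close>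

definition vacant :: "('n \<Rightarrow> 'k) \<Rightarrow> 'k set \<Rightarrow> ('n \<Rightarrow> 'k) \<Rightarrow> 'k set" where
  "vacant a Ks g = {j\<in>Ks. choosers a j = {} \<and> j \<notin> g ` misplaced a Ks}"

text \<open>The vacant arms are filled one after the other, \<open>R\<close> being the players not yet recommended.\<close>

primrec fills ::
  "('n \<Rightarrow> 'k \<Rightarrow> real) \<Rightarrow> ('n \<Rightarrow> 'k) \<Rightarrow> ('n \<Rightarrow> 'k) \<Rightarrow> 'n set \<Rightarrow> 'k list \<Rightarrow> bool" where
  "fills m a g R [] \<longleftrightarrow> True"
| "fills m a g R (j # js) \<longleftrightarrow>
     (\<exists>l. is_arg_min (\<lambda>n. m n (a n) / real (card (choosers a (a n))) - m n j)
            (\<lambda>n. n \<in> R \<and> card (choosers a (a n)) > 1) l \<and>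
          g l = j \<and> fills m a g (R - {l}) js)"

text \<open>\<open>\<mu>a\<close> are the aggregated means; \<open>T n j\<close> is the threshold of \<open>n\<close> for switching from \<open>a n\<close> to \<open>j\<close>.\<close>

definition cisp_recommendation ::
  "('n \<Rightarrow> 'k \<Rightarrow> ereal) \<Rightarrow> ('k \<Rightarrow> real) \<Rightarrow> ('n \<Rightarrow> 'k \<Rightarrow> real) \<Rightarrow> ('n \<Rightarrow> 'k) \<Rightarrow> 'k set
     \<Rightarrow> ('k \<Rightarrow> 'n) \<Rightarrow> ('n \<Rightarrow> 'k) \<Rightarrow> bool" where
  "cisp_recommendation T \<mu>a m a Ks h g \<longleftrightarrow>
     (\<forall>n\<in>misplaced a Ks. g n \<in> Ks \<and> choosers a (g n) = {} \<and> T n (g n) < ereal (\<mu>a (g n))) \<and>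
     inj_on g (misplaced a Ks) \<and>
     (\<forall>n. a n \<in> Ks \<and> card (choosers a (a n)) = 1 \<longrightarrow> g n = a n) \<and>
     (\<forall>i. card (choosers a i) > 1 \<longrightarrow> is_arg_max (\<lambda>n. m n i) (\<lambda>n. n \<in> choosers a i) (h i)) \<and>
     (\<forall>i\<in>congested a Ks. g (h i) = i) \<and>
     (\<exists>js. distinct js \<and> set js = vacant a Ks g \<and>
           fills m a g (- (misplaced a Ks \<union> h ` congested a Ks)) js)"

definition step3_charge ::
  "('n \<Rightarrow> 'k \<Rightarrow> real) \<Rightarrow> ('n \<Rightarrow> 'k) \<Rightarrow> ('k \<Rightarrow> 'n) \<Rightarrow> 'k \<Rightarrow> real" where
  "step3_charge m a h i =
     (real (card (choosers a i)) - 1) / real (card (choosers a i)) * m (h i) i"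

definition step3_reward ::
  "('n \<Rightarrow> 'k \<Rightarrow> real) \<Rightarrow> ('n \<Rightarrow> 'k) \<Rightarrow> ('k \<Rightarrow> 'n) \<Rightarrow> 'n \<Rightarrow> 'k \<Rightarrow> real" where
  "step3_reward m a h l j = m (h (a l)) (a l) / real (card (choosers a (a l))) - m l j"

text \<open>
  The planner's budget in one round when the final decisions are \<open>d\<close>. The first charge is due upon
  recommendation, whatever the player then does. A deviator's penalty is passed on in full to every
  player who was recommended the arm the deviator has taken.
\<close>

definition cisp_budget ::
  "real \<Rightarrow> ('n::finite \<Rightarrow> 'k::finite \<Rightarrow> real) \<Rightarrow> ('n \<Rightarrow> 'k) \<Rightarrow> 'k set \<Rightarrow> ('k \<Rightarrow> 'n) \<Rightarrow> ('n \<Rightarrow> 'k)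
     \<Rightarrow> ('n \<Rightarrow> 'k) \<Rightarrow> real" where
  "cisp_budget \<Psi> m a Ks h g d =
     ((\<Sum>i\<in>congested a Ks. step3_charge m a h i)
      + (\<Sum>l | g l \<in> vacant a Ks g \<and> d l = a l. step3_charge m a h (a l))
      + (\<Sum>n | d n \<noteq> g n. \<Psi>))
     - ((\<Sum>l | g l \<in> vacant a Ks g \<and> d l = g l. step3_reward m a h l (g l))
        + (\<Sum>n | d n \<noteq> g n. \<Sum>l | g l = d n. \<Psi>))"

definition in_horizon :: "enat \<Rightarrow> nat \<Rightarrow> bool" where
  "in_horizon H t \<longleftrightarrow> 1 \<le> t \<and> enat t \<le> H"

definition ex_post_budget_balance :: "enat \<Rightarrow> (nat \<Rightarrow> real) \<Rightarrow> bool" where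
  "ex_post_budget_balance H budget \<longleftrightarrow> (\<forall>t. in_horizon H t \<longrightarrow> 0 \<le> budget t)"

text \<open>
  A run of the mechanism along one sample path, in which \<open>s t\<close>, \<open>g t\<close> and \<open>d t\<close> are the selfish,
  recommended and final decisions. The final decisions are unrestricted: they need not follow the
  recommendations. Thresholds are evaluated at the aggregated means and the player's own counts.
\<close>

definition optimal_arms ::
  "('k \<Rightarrow> real) \<Rightarrow> ('k belief \<Rightarrow> 'n::finite \<Rightarrow> 'k) \<Rightarrow> ('k \<Rightarrow> nat \<Rightarrow> bool)
     \<Rightarrow> ('k \<Rightarrow> nat \<Rightarrow> 'n set \<Rightarrow> 'n) \<Rightarrow> (nat \<Rightarrow> 'n \<Rightarrow> 'k) \<Rightarrow> nat \<Rightarrow> 'k set" where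
  "optimal_arms \<theta>a P x v d t = range (P (agg_mean \<theta>a x v d t, total_pulls v d t))"

definition cisp_run ::
  "enat \<Rightarrow> real \<Rightarrow> ('n::finite \<Rightarrow> 'k::finite \<Rightarrow> real) \<Rightarrow> ('k \<Rightarrow> real)
     \<Rightarrow> ('n \<Rightarrow> ('k \<Rightarrow> real) \<Rightarrow> 'n \<Rightarrow> 'k) \<Rightarrow> ('n \<Rightarrow> 'k belief \<Rightarrow> real) \<Rightarrow> ('k belief \<Rightarrow> 'n \<Rightarrow> 'k)
     \<Rightarrow> ('k \<Rightarrow> nat \<Rightarrow> bool) \<Rightarrow> ('k \<Rightarrow> nat \<Rightarrow> 'n set \<Rightarrow> 'n)
     \<Rightarrow> (nat \<Rightarrow> 'n \<Rightarrow> 'k) \<Rightarrow> (nat \<Rightarrow> 'k \<Rightarrow> 'n) \<Rightarrow> (nat \<Rightarrow> 'n \<Rightarrow> 'k) \<Rightarrow> (nat \<Rightarrow> 'n \<Rightarrow> 'k) \<Rightarrow> bool" where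
  "cisp_run H \<rho> \<theta> \<theta>a e V P x v s h g d \<longleftrightarrow>
     (\<forall>t. in_horizon H t \<longrightarrow>
        (\<forall>n. is_arg_max
               (selfish_payoff \<rho> n (e n) (V n) (emp_mean \<theta> x v d n t, pulls v d n t))
               (\<lambda>_. True) (s t n)) \<and>
        cisp_recommendation
          (\<lambda>n j. exploration_threshold \<rho> n (e n) (V n)
                   (agg_mean \<theta>a x v d t, pulls v d n t) j (s t n))
          (agg_mean \<theta>a x v d t) (\<lambda>n. emp_mean \<theta> x v d n t)
          (s t) (optimal_arms \<theta>a P x v d t) (h t) (g t))"

end

theory Submission
  imports Defs
begin

text \<open>
  The recommended profile reaches every optimal arm, and there are as many optimal arms as players,
  so it is injective. Hence a deviator's penalty compensates at most one player. Every player
  rewarded in Step 3 leaves a congested optimal arm \<open>i\<close> and differs from \<open>h i\<close>, so at most \<open>c - 1\<close>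
  of the \<open>c\<close> players on \<open>i\<close> are rewarded; each of them gets at most a \<open>c\<close>-th of the best mean
  reported for \<open>i\<close>, and the charge on \<open>h i\<close> covers this.
\<close>

lemma reward_nonneg: "0 \<le> reward x v f n k t"
  by (simp add: reward_def)

lemma emp_mean_nonneg:
  assumes "\<And>n k. 0 \<le> \<theta> n k"
  shows "0 \<le> emp_mean \<theta> x v f n t k"
  using assms by (auto simp: emp_mean_def reward_nonneg intro!: divide_nonneg_nonneg sum_nonneg)

text \<open>A reward is at most 1 and vanishes in every round that \<open>pulls\<close> does not
  count, so the bound holds round by round.\<close>

lemma sum_rewards_le_pulls:
  "(\<Sum>\<tau>\<in>{1..<t}. of_bool (f \<tau> n = k) * reward x v f n k \<tau>) \<le> real (pulls v f n t k)"
proof -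
  have "(\<Sum>\<tau>\<in>{1..<t}. of_bool (f \<tau> n = k) * reward x v f n k \<tau>)
      \<le> (\<Sum>\<tau>\<in>{1..<t}. of_bool (f \<tau> n = k \<and> \<not> collides v f \<tau> n))"
    by (intro sum_mono) (simp add: reward_def)
  also have "\<dots> = real (pulls v f n t k)"
    by (simp add: pulls_def Int_def)
  finally show ?thesis .
qed

text \<open>Makes the aggregated belief a \<open>valid_belief\<close>, which is where
  \<open>socially_optimal\<close> constrains the policy.\<close>

lemma agg_mean_bounds:
  fixes f :: "nat \<Rightarrow> 'n::finite \<Rightarrow> 'k"
  assumes "\<And>k. 0 \<le> \<theta>a k \<and> \<theta>a k \<le> 1"
  shows "0 \<le> agg_mean \<theta>a x v f t k \<and> agg_mean \<theta>a x v f t k \<le> 1"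
proof (cases "total_pulls v f t k = 0")
  case True
  then show ?thesis using assms by (simp add: agg_mean_def)
next
  case False
  let ?S = "\<Sum>\<tau>\<in>{1..<t}. \<Sum>n\<in>UNIV. of_bool (f \<tau> n = k) * reward x v f n k \<tau>"
  have "0 \<le> ?S"
    by (intro sum_nonneg mult_nonneg_nonneg) (simp_all add: reward_nonneg)
  \<comment> \<open>Once the sums are exchanged, the bound for a single player applies to each
    summand.\<close>
  moreover have "?S \<le> real (total_pulls v f t k)"
    unfolding total_pulls_def of_nat_sum
    by (subst sum.swap) (intro sum_mono sum_rewards_le_pulls)
  ultimately show ?thesis using False by (simp add: agg_mean_def)
qed

lemma fills_subset_range: "fills m a g R js \<Longrightarrow> set js \<subseteq> range g"
  by (induction js arbitrary: R) auto

text \<open>An optimal arm with several choosers is recommended to its player \<open>h k\<close>, a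
  sole chooser keeps it, and an unchosen one is assigned in Step 2 or filled in Step 3.\<close>

lemma cisp_recommendation_surj:
  fixes a :: "'n::finite \<Rightarrow> 'k"
  assumes "cisp_recommendation T \<mu>a m a Ks h g"
  shows "Ks \<subseteq> range g"
proof
  fix k assume k: "k \<in> Ks"
  show "k \<in> range g"
  proof (cases "card (choosers a k) > 1")
    case True
    then have "g (h k) = k"
      using assms k by (auto simp: cisp_recommendation_def congested_def)
    then show ?thesis by (metis rangeI)
  next
    case not_congested: False
    show ?thesis
    proof (cases "choosers a k = {}")
      case True
      obtain js where "set js = vacant a Ks g"
          "fills m a g (- (misplaced a Ks \<union> h ` congested a Ks)) js"
        using assms by (auto simp: cisp_recommendation_def)
      then have "vacant a Ks g \<subseteq> range g"
        by (metis fills_subset_range)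
      \<comment> \<open>An unchosen optimal arm that is not vacant is already the recommendation of
        a misplaced player.\<close>
      with True k show ?thesis by (auto simp: vacant_def)
    next
      case False
      then obtain n where n: "a n = k" by (auto simp: choosers_def)
      have "card (choosers a k) = 1"
        using False not_congested card_gt_0_iff[of "choosers a k"] by auto
      then have "g n = k"
        using assms k n by (simp add: cisp_recommendation_def)
      then show ?thesis by blast
    qed
  qed
qed

lemma cisp_recommendation_inj:
  fixes g :: "'n::finite \<Rightarrow> 'k"
  assumes "cisp_recommendation T \<mu>a m a Ks h g" and "card Ks = CARD('n)"
  shows "inj g"
proof -
  have "CARD('n) \<le> card (range g)"
    using card_mono[OF _ cisp_recommendation_surj[OF assms(1)]] assms(2) by simp
  then have "card (range g) = CARD('n)"
    using card_image_le[of UNIV g] by simp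
  then show ?thesis by (simp add: eq_card_imp_inj_on)
qed

text \<open>A player sent to a vacant arm moves, whereas the sole chooser of an optimal arm and the
  player \<open>h i\<close> of a congested arm \<open>i\<close> both stay.\<close>

lemma vacant_recommended_congested:
  fixes a :: "'n::finite \<Rightarrow> 'k"
  assumes rec: "cisp_recommendation T \<mu>a m a Ks h g" and l: "g l \<in> vacant a Ks g"
  shows "a l \<in> congested a Ks" and "l \<noteq> h (a l)"
proof -
  \<comment> \<open>\<open>vacant\<close> leaves out the arms recommended to misplaced players, so
    the selfish arm of \<open>l\<close> is optimal.\<close>
  have unchosen: "choosers a (g l) = {}" and "l \<notin> misplaced a Ks"
    using l by (auto simp: vacant_def)
  then have in_Ks: "a l \<in> Ks" by (simp add: misplaced_def)
  have "l \<in> choosers a (a l)" by (simp add: choosers_def)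
  then have kept: "g l \<noteq> a l" and "card (choosers a (a l)) \<noteq> 0"
    using unchosen by auto
  moreover have "card (choosers a (a l)) \<noteq> 1"
    using rec in_Ks kept by (auto simp: cisp_recommendation_def)
  ultimately have "card (choosers a (a l)) > 1"
    by linarith
  then show cong: "a l \<in> congested a Ks"
    using in_Ks by (simp add: congested_def)
  then have "g (h (a l)) = a l"
    using rec by (simp add: cisp_recommendation_def)
  with kept show "l \<noteq> h (a l)" by metis
qed

text \<open>Each reward is accounted to the arm that the player leaves, not to the one it fills: the
  rewards are grouped by \<open>a l\<close>.\<close>

lemma step3_rewards_le_charges:
  fixes a :: "'n::finite \<Rightarrow> 'k::finite"
  assumes rec: "cisp_recommendation T \<mu>a m a Ks h g"
    and nonneg: "\<And>n k. 0 \<le> m n k"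
    and L: "\<And>l. l \<in> L \<Longrightarrow> g l \<in> vacant a Ks g"
  shows "(\<Sum>l\<in>L. step3_reward m a h l (g l)) \<le> (\<Sum>i\<in>congested a Ks. step3_charge m a h i)"
proof -
  have "(\<Sum>l\<in>L. step3_reward m a h l (g l))
      \<le> (\<Sum>l\<in>L. m (h (a l)) (a l) / real (card (choosers a (a l))))"
    \<comment> \<open>Dropping the subtracted mean \<open>m l (g l)\<close> leaves a bound that
      depends on \<open>l\<close> only through \<open>a l\<close>.\<close>
    by (intro sum_mono) (simp add: step3_reward_def nonneg)
  also have "\<dots> = (\<Sum>i\<in>congested a Ks. \<Sum>l | l \<in> L \<and> a l = i.
      m (h (a l)) (a l) / real (card (choosers a (a l))))"
    using vacant_recommended_congested(1)[OF rec L] by (intro sum.group[symmetric]) auto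
  also have "\<dots> \<le> (\<Sum>i\<in>congested a Ks. step3_charge m a h i)"
  proof (intro sum_mono)
    fix i assume i: "i \<in> congested a Ks"
    have hi: "h i \<in> choosers a i"
      using rec i by (auto simp: cisp_recommendation_def congested_def is_arg_max_def)
    \<comment> \<open>Leaving out \<open>h i\<close> gives the \<open>- 1\<close> in the numerator
      of \<open>step3_charge\<close>.\<close>
    have "{l. l \<in> L \<and> a l = i} \<subseteq> choosers a i - {h i}"
      using vacant_recommended_congested(2)[OF rec L] by (auto simp: choosers_def)
    then have "card {l. l \<in> L \<and> a l = i} \<le> card (choosers a i) - 1"
      using hi by (metis card_Diff_singleton card_mono finite)
    moreover have "card (choosers a i) > 1"
      using i by (simp add: congested_def)
    ultimately have le: "real (card {l. l \<in> L \<and> a l = i}) \<le> real (card (choosers a i)) - 1"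
      by linarith
    have "(\<Sum>l | l \<in> L \<and> a l = i. m (h (a l)) (a l) / real (card (choosers a (a l))))
        = real (card {l. l \<in> L \<and> a l = i}) * (m (h i) i / real (card (choosers a i)))"
      by simp
    also have "\<dots> \<le> (real (card (choosers a i)) - 1) * (m (h i) i / real (card (choosers a i)))"
      using le nonneg by (intro mult_right_mono) simp_all
    finally show "(\<Sum>l | l \<in> L \<and> a l = i. m (h (a l)) (a l) / real (card (choosers a (a l))))
        \<le> step3_charge m a h i"
      by (simp add: step3_charge_def)
  qed
  finally show ?thesis .
qed

lemma step3_charge_nonneg:
  fixes a :: "'n::finite \<Rightarrow> 'k"
  assumes "\<And>n k. 0 \<le> m n k"
  shows "0 \<le> step3_charge m a h (a l)"
proof -
  \<comment> \<open>The arm \<open>a l\<close> is chosen at least by \<open>l\<close>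
    itself.\<close>
  have "card (choosers a (a l)) > 0"
    by (auto simp: card_gt_0_iff choosers_def)
  then have "0 \<le> real (card (choosers a (a l))) - 1" by linarith
  then show ?thesis using assms by (simp add: step3_charge_def)
qed

text \<open>If the arm \<open>d n\<close> is recommended to nobody, the inner sum is empty and the
  planner keeps the penalty; otherwise injectivity leaves a single summand.\<close>

lemma compensation_le_penalties:
  fixes g d :: "'n::finite \<Rightarrow> 'k"
  assumes "inj g" and "0 \<le> \<Psi>"
  shows "(\<Sum>n | d n \<noteq> g n. \<Sum>l | g l = d n. \<Psi>) \<le> (\<Sum>n | d n \<noteq> g n. \<Psi> :: real)"
proof (rule sum_mono)
  fix n
  have "card {l. g l = d n} \<le> 1"
    using assms(1) by (simp add: card_le_Suc0_iff_eq inj_eq) (metis injD)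
  then have "real (card {l. g l = d n}) * \<Psi> \<le> 1 * \<Psi>"
    using assms(2) by (intro mult_right_mono) simp_all
  then show "(\<Sum>l | g l = d n. \<Psi>) \<le> \<Psi>" by simp
qed

text \<open>The two kinds of payment are covered separately: rewards by the charges on congested
  arms, compensations by penalties. Charges on players who refuse to move only add to the budget.
  The final decisions \<open>d\<close> are arbitrary.\<close>

lemma cisp_budget_nonneg:
  fixes a :: "'n::finite \<Rightarrow> 'k::finite"
  assumes rec: "cisp_recommendation T \<mu>a m a Ks h g"
    and nonneg: "\<And>n k. 0 \<le> m n k"
    and Ks: "card Ks = CARD('n)" and penalty: "0 \<le> \<Psi>"
  shows "0 \<le> cisp_budget \<Psi> m a Ks h g d"
proof -
  have "0 \<le> (\<Sum>l | g l \<in> vacant a Ks g \<and> d l = a l. step3_charge m a h (a l))"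
    using nonneg by (intro sum_nonneg step3_charge_nonneg)
  moreover have "(\<Sum>l | g l \<in> vacant a Ks g \<and> d l = g l. step3_reward m a h l (g l))
      \<le> (\<Sum>i\<in>congested a Ks. step3_charge m a h i)"
    by (rule step3_rewards_le_charges[OF rec nonneg]) simp
  moreover have "(\<Sum>n | d n \<noteq> g n. \<Sum>l | g l = d n. \<Psi>) \<le> (\<Sum>n | d n \<noteq> g n. \<Psi>)"
    by (rule compensation_le_penalties[OF cisp_recommendation_inj[OF rec Ks] penalty])
  ultimately show ?thesis by (simp only: cisp_budget_def)
qed

text \<open>Supplies the count behind the injectivity of the recommendation; the policy assigns
  distinct arms at every valid belief.\<close>

lemma card_optimal_arms:
  fixes P :: "'k::finite belief \<Rightarrow> 'n::finite \<Rightarrow> 'k"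
  assumes "socially_optimal \<rho> V P" and "\<And>k. 0 \<le> \<theta>a k \<and> \<theta>a k \<le> 1"
  shows "card (optimal_arms \<theta>a P x v f t) = CARD('n)"
proof -
  have "valid_belief (agg_mean \<theta>a x v f t, total_pulls v f t)"
    using assms(2) by (auto simp: valid_belief_def agg_mean_bounds)
  then have "inj (P (agg_mean \<theta>a x v f t, total_pulls v f t))"
    using assms(1) unfolding socially_optimal_def by blast
  then show ?thesis by (simp add: optimal_arms_def card_image)
qed

theorem lemma4:
  fixes M :: "'w measure"
    and \<mu> :: "'k::finite \<Rightarrow> real" and \<eta> \<rho> \<Psi> :: real
    and r :: "'k \<Rightarrow> nat \<Rightarrow> 'w \<Rightarrow> bool"
    and w :: "'k \<Rightarrow> nat \<Rightarrow> 'n::finite set \<Rightarrow> 'w \<Rightarrow> 'n"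
    and \<theta> :: "'n \<Rightarrow> 'k \<Rightarrow> real" and \<theta>a :: "'k \<Rightarrow> real"
    and e :: "'n \<Rightarrow> ('k \<Rightarrow> real) \<Rightarrow> 'n \<Rightarrow> 'k"
    and V :: "'n \<Rightarrow> 'k belief \<Rightarrow> real"
    and Vopt :: "'k belief \<Rightarrow> real" and P :: "'k belief \<Rightarrow> 'n \<Rightarrow> 'k"
    and H :: enat and \<omega> :: 'w
    and s g d :: "nat \<Rightarrow> 'n \<Rightarrow> 'k" and h :: "nat \<Rightarrow> 'k \<Rightarrow> 'n"
  defines "x \<equiv> (\<lambda>k t. r k t \<omega>)" and "v \<equiv> (\<lambda>k t S. w k t S \<omega>)"
  assumes environment: "bandit_environment M \<mu> \<eta> r w"
    and discount: "0 < \<rho>" "\<rho> < 1"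
    and penalty: "1 < \<Psi>"
    and preferences: "\<And>n k. 0 \<le> \<theta> n k \<and> \<theta> n k \<le> 1" "\<And>k. 0 \<le> \<theta>a k \<and> \<theta>a k \<le> 1"
    and estimates: "\<And>n. equilibrium_estimate (e n)"
    and selfish: "\<And>n. selfish_value \<rho> n (e n) (V n)"
    and social: "socially_optimal \<rho> Vopt P"
    and path: "\<omega> \<in> space M"
    and run: "cisp_run H \<rho> \<theta> \<theta>a e V P x v s h g d"
  shows "ex_post_budget_balance H
           (\<lambda>t. cisp_budget \<Psi> (\<lambda>n. emp_mean \<theta> x v d n t) (s t)
                  (optimal_arms \<theta>a P x v d t) (h t) (g t) (d t))"
  unfolding ex_post_budget_balance_def
proof (intro allI impI)
  \<comment> \<open>Each round is balanced on its own, without surplus carried over from earlier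
    rounds.\<close>
  fix t assume "in_horizon H t"
  then have "cisp_recommendation
      (\<lambda>n j. exploration_threshold \<rho> n (e n) (V n) (agg_mean \<theta>a x v d t, pulls v d n t) j (s t n))
      (agg_mean \<theta>a x v d t) (\<lambda>n. emp_mean \<theta> x v d n t)
      (s t) (optimal_arms \<theta>a P x v d t) (h t) (g t)"
    using run by (simp add: cisp_run_def)
  then show "0 \<le> cisp_budget \<Psi> (\<lambda>n. emp_mean \<theta> x v d n t) (s t)
      (optimal_arms \<theta>a P x v d t) (h t) (g t) (d t)"
    using preferences penalty card_optimal_arms[OF social preferences(2)]
    by (intro cisp_budget_nonneg emp_mean_nonneg) auto
qed

end
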